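(* Let $X,Y$ be metric spaces. If $f\colon X\to Y$ is a bi-Lipschitz onto map, then $\dim_{tH}X=\dim_{tH}Y$.
   Context: A map $f\colon X\to Y$ is bi-Lipschitz if it is a bijection and both $f$ and $f^{-1}$ are Lipschitz. $\dim_H$ denotes Hausdorff dimension, with the convention $\dim_H\emptyset=-1$. The topological Hausdorff dimension is defined by $\dim_{tH}\emptyset=-1$ and, for a non-empty metric space $X$, $\dim_{tH}X=\inf\{d: X \text{ has a basis } \mathcal U \text{ of open sets such that } \dim_H\partial U\le d-1 \text{ for every } U\in\mathcal U\}$ (where $d=\infty$ is allowed, with $\infty-1=\infty$). *)

theory Defs
  imports "HOL-Analysis.Analysis"
begin

text \<open>Metric spaces are values of type \<open>'a metric\<close>, so the carrier \<^term>\<open>mspace m\<close>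
  may be empty and need not exhaust the type.\<close>

definition ediam :: "'a metric \<Rightarrow> 'a set \<Rightarrow> ennreal" where
  "ediam m A = (SUP x\<in>A. SUP y\<in>A. ennreal (mdist m x y))"

text \<open>The weight \<open>(diam A)^s\<close>. The conventions are the usual ones: the empty set has
  weight 0 for every \<open>s\<close>, and \<open>0^0 = 1\<close> for non-empty \<open>A\<close> (whereas \<open>0 powr 0 = 0\<close>), so that the
  case \<open>s = 0\<close> yields the counting measure. It is used only for sets of finite diameter.\<close>

definition diam_pow :: "'a metric \<Rightarrow> real \<Rightarrow> 'a set \<Rightarrow> ennreal" where
  "diam_pow m s A =
     (if A = {} then 0 else if s = 0 then 1 else ennreal (enn2real (ediam m A) powr s))"

text \<open>Total Hausdorff pre-measure and measure of a metric space. Finite covers are included, since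
  members of the sequence may be empty. If there is no admissible countable cover, the infimum
  is \<open>\<infinity>\<close>.\<close>

definition hausdorff_premeasure :: "real \<Rightarrow> real \<Rightarrow> 'a metric \<Rightarrow> ennreal" where
  "hausdorff_premeasure s \<delta> m =
     Inf {(\<Sum>i. diam_pow m s (A i)) | A :: nat \<Rightarrow> 'a set.
            mspace m = (\<Union>i. A i) \<and> (\<forall>i. ediam m (A i) \<le> ennreal \<delta>)}"

text \<open>The supremum over \<open>\<delta> > 0\<close> is the limit as \<open>\<delta>\<close> tends to 0, because the pre-measure
  is antimonotone in \<open>\<delta>\<close>.\<close>

definition hausdorff_measure :: "real \<Rightarrow> 'a metric \<Rightarrow> ennreal" where
  "hausdorff_measure s m = (SUP \<delta>\<in>{0<..}. hausdorff_premeasure s \<delta> m)"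

definition hausdorff_dim :: "'a metric \<Rightarrow> ereal" where
  "hausdorff_dim m =
     (if mspace m = {} then -1
      else Inf {ereal s | s. 0 \<le> s \<and> hausdorff_measure s m < \<infinity>})"

definition topology_basis :: "'a topology \<Rightarrow> 'a set set \<Rightarrow> bool" where
  "topology_basis T \<U> \<longleftrightarrow>
     (\<forall>U\<in>\<U>. openin T U) \<and>
     (\<forall>V x. openin T V \<and> x \<in> V \<longrightarrow> (\<exists>U\<in>\<U>. x \<in> U \<and> U \<subseteq> V))"

text \<open>In \<open>ereal\<close> one has \<open>\<infinity> - 1 = \<infinity>\<close>, so the set below always contains \<open>\<infinity>\<close>.
  The boundary is taken in \<open>m\<close> and viewed as a metric space of its own.\<close>

definition top_hausdorff_dim :: "'a metric \<Rightarrow> ereal" where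
  "top_hausdorff_dim m =
     (if mspace m = {} then -1
      else Inf {d :: ereal. \<exists>\<U>. topology_basis (mtopology_of m) \<U> \<and>
             (\<forall>U\<in>\<U>. hausdorff_dim (submetric m (mtopology_of m frontier_of U)) \<le> d - 1)})"

definition bi_lipschitz :: "'a metric \<Rightarrow> 'b metric \<Rightarrow> ('a \<Rightarrow> 'b) \<Rightarrow> bool" where
  "bi_lipschitz X Y f \<longleftrightarrow>
     bij_betw f (mspace X) (mspace Y) \<and>
     Lipschitz_continuous_map X Y f \<and>
     Lipschitz_continuous_map Y X (inv_into (mspace X) f)"

end

theory Submission
  imports Defs
begin

text \<open>A Lipschitz surjection with constant \<open>B > 0\<close> turns a countable cover by
  sets of diameter at most \<open>d\<close> into one by sets of diameter at most
  \<open>B * d\<close>, and multiplies each weight of exponent \<open>s\<close> by at most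
  \<open>B powr s\<close>. Letting \<open>d\<close> tend to 0, the Hausdorff measure grows by at
  most this finite factor, so finiteness survives for every \<open>s\<close> and the Hausdorff
  dimension cannot increase (\<open>hausdorff_dim_image_le\<close>).

  A bi-Lipschitz map is moreover a homeomorphism, so it carries a basis to a basis and the frontier
  of each member to the frontier of its image; between these frontiers it is again a Lipschitz
  surjection. Hence any \<open>d\<close> admissible in the infimum for \<open>X\<close> is
  admissible for \<open>Y\<close> (\<open>top_hausdorff_dim_bi_lipschitz_le\<close>). The inverse
  map gives the other inequality.\<close>

lemma ediam_image_le:
  assumes "A \<subseteq> mspace X"
    and lip: "\<And>x y. x \<in> mspace X \<Longrightarrow> y \<in> mspace X \<Longrightarrow> mdist Y (f x) (f y) \<le> B * mdist X x y"
    and "0 \<le> B"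
  shows "ediam Y (f ` A) \<le> ennreal B * ediam X A"
  unfolding ediam_def
proof (clarsimp simp: image_image intro!: SUP_least)
  fix x y assume xy: "x \<in> A" "y \<in> A"
  have "ennreal (mdist Y (f x) (f y)) \<le> ennreal (B * mdist X x y)"
    using xy assms by (intro ennreal_leI lip) auto
  also have "\<dots> = ennreal B * ennreal (mdist X x y)"
    using \<open>0 \<le> B\<close> by (simp add: ennreal_mult)
  also have "\<dots> \<le> ennreal B * (SUP x\<in>A. SUP y\<in>A. ennreal (mdist X x y))"
    by (intro mult_left_mono SUP_upper2[OF xy(1)] SUP_upper2[OF xy(2)] order_refl) auto
  finally show "ennreal (mdist Y (f x) (f y)) \<le> \<dots>" .
qed

lemma diam_pow_image_le:
  assumes "A \<subseteq> mspace X"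
    and lip: "\<And>x y. x \<in> mspace X \<Longrightarrow> y \<in> mspace X \<Longrightarrow> mdist Y (f x) (f y) \<le> B * mdist X x y"
    and "0 < B" "0 \<le> s" "ediam X A < \<infinity>"
  shows "diam_pow Y s (f ` A) \<le> ennreal (B powr s) * diam_pow X s A"
proof (cases "A = {} \<or> s = 0")
  case True
  then show ?thesis using \<open>0 < B\<close> by (auto simp: diam_pow_def)
next
  case False
  \<comment> \<open>As \<open>enn2real\<close> sends infinity to 0, it is monotone only below a
    finite bound; the finite diameter of \<open>A\<close> supplies one.\<close>
  have "enn2real (ediam Y (f ` A)) \<le> enn2real (ennreal B * ediam X A)"
    using assms ediam_image_le[OF assms(1) lip]
    by (intro enn2real_mono) (auto simp: ennreal_mult_less_top)
  also have "\<dots> = B * enn2real (ediam X A)"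
    using \<open>0 < B\<close> by (simp add: enn2real_mult)
  finally have "enn2real (ediam Y (f ` A)) powr s \<le> (B * enn2real (ediam X A)) powr s"
    using \<open>0 \<le> s\<close> by (intro powr_mono2) auto
  also have "\<dots> = B powr s * enn2real (ediam X A) powr s"
    using \<open>0 < B\<close> by (simp add: powr_mult)
  finally show ?thesis
    using False by (simp add: diam_pow_def ennreal_mult[symmetric] ennreal_leI)
qed

lemma hausdorff_premeasure_image_le:
  assumes surj: "f ` mspace X = mspace Y"
    and lip: "\<And>x y. x \<in> mspace X \<Longrightarrow> y \<in> mspace X \<Longrightarrow> mdist Y (f x) (f y) \<le> B * mdist X x y"
    and "0 < B" "0 \<le> s" "0 \<le> \<delta>"
  shows "hausdorff_premeasure s (B * \<delta>) Y \<le> ennreal (B powr s) * hausdorff_premeasure s \<delta> X"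
proof -
  define c where "c = B powr s"
  have c: "0 < c" using \<open>0 < B\<close> by (simp add: c_def)
  \<comment> \<open>With the constant moved to the left, it suffices to bound the weight sum of each
    single cover and invoke the infimum property. Multiplying back at the end is valid because
    \<open>c\<close> is positive and finite.\<close>
  have "hausdorff_premeasure s (B * \<delta>) Y / ennreal c \<le> hausdorff_premeasure s \<delta> X"
    unfolding hausdorff_premeasure_def[of s \<delta> X]
  proof (clarsimp intro!: Inf_greatest)
    fix A :: "nat \<Rightarrow> _ set"
    assume cover: "mspace X = (\<Union>i. A i)" and small: "\<forall>i. ediam X (A i) \<le> ennreal \<delta>"
    have A: "A i \<subseteq> mspace X" for i using cover by auto
    have fin: "ediam X (A i) < \<infinity>" for i
      using small by (auto intro: le_less_trans)
    have "ediam Y (f ` A i) \<le> ennreal (B * \<delta>)" for i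
    proof -
      have "ediam Y (f ` A i) \<le> ennreal B * ediam X (A i)"
        using ediam_image_le[OF A lip] \<open>0 < B\<close> by simp
      also have "\<dots> \<le> ennreal B * ennreal \<delta>"
        using small by (intro mult_left_mono) auto
      finally show ?thesis using assms by (simp add: ennreal_mult)
    qed
    moreover have "mspace Y = (\<Union>i. f ` A i)"
      using surj cover by (simp add: image_UN)
    ultimately have "hausdorff_premeasure s (B * \<delta>) Y \<le> (\<Sum>i. diam_pow Y s (f ` A i))"
      unfolding hausdorff_premeasure_def by (intro Inf_lower CollectI exI[of _ "\<lambda>i. f ` A i"]) auto
    also have "\<dots> \<le> (\<Sum>i. ennreal c * diam_pow X s (A i))"
      unfolding c_def using diam_pow_image_le[OF A lip \<open>0 < B\<close> \<open>0 \<le> s\<close> fin]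
      by (intro suminf_le) auto
    finally have "hausdorff_premeasure s (B * \<delta>) Y \<le> ennreal c * (\<Sum>i. diam_pow X s (A i))"
      by simp
    then show "hausdorff_premeasure s (B * \<delta>) Y / ennreal c \<le> (\<Sum>i. diam_pow X s (A i))"
      using c by (intro divide_le_posI_ennreal) auto
  qed
  then have "hausdorff_premeasure s (B * \<delta>) Y / ennreal c * ennreal c
      \<le> hausdorff_premeasure s \<delta> X * ennreal c"
    by (rule mult_right_mono) simp
  moreover have "hausdorff_premeasure s (B * \<delta>) Y / ennreal c * ennreal c
      = hausdorff_premeasure s (B * \<delta>) Y"
    using c by (simp add: ennreal_divide_times)
  ultimately show ?thesis by (simp add: c_def mult.commute)
qed

lemma hausdorff_measure_image_le:
  assumes surj: "f ` mspace X = mspace Y"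
    and lip: "\<And>x y. x \<in> mspace X \<Longrightarrow> y \<in> mspace X \<Longrightarrow> mdist Y (f x) (f y) \<le> B * mdist X x y"
    and "0 < B" "0 \<le> s"
  shows "hausdorff_measure s Y \<le> ennreal (B powr s) * hausdorff_measure s X"
  unfolding hausdorff_measure_def[of s Y]
proof (rule SUP_least)
  fix \<delta> :: real assume "\<delta> \<in> {0<..}"
  \<comment> \<open>Covers of \<open>X\<close> at scale \<open>\<delta> / B\<close> have images at
    scale \<open>\<delta>\<close>, and every positive scale is allowed in the supremum for
    \<open>X\<close>.\<close>
  then have d: "0 < \<delta> / B" using \<open>0 < B\<close> by simp
  have "hausdorff_premeasure s \<delta> Y = hausdorff_premeasure s (B * (\<delta> / B)) Y"
    using \<open>0 < B\<close> by simp
  also have "\<dots> \<le> ennreal (B powr s) * hausdorff_premeasure s (\<delta> / B) X"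
    using d assms by (intro hausdorff_premeasure_image_le[where f = f]) auto
  also have "\<dots> \<le> ennreal (B powr s) * hausdorff_measure s X"
    unfolding hausdorff_measure_def using d by (intro mult_left_mono SUP_upper) auto
  finally show "hausdorff_premeasure s \<delta> Y \<le> \<dots>" .
qed

lemma hausdorff_dim_image_le:
  assumes surj: "f ` mspace X = mspace Y" and lip: "Lipschitz_continuous_map X Y f"
  shows "hausdorff_dim Y \<le> hausdorff_dim X"
proof (cases "mspace X = {}")
  case True
  then show ?thesis using surj by (auto simp: hausdorff_dim_def)
next
  case False
  then have Y: "mspace Y \<noteq> {}" using surj by auto
  obtain B where B: "0 < B"
    "\<And>x y. x \<in> mspace X \<Longrightarrow> y \<in> mspace X \<Longrightarrow> mdist Y (f x) (f y) \<le> B * mdist X x y"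
    using lip unfolding Lipschitz_continuous_map_pos by blast
  \<comment> \<open>Every exponent that counts for \<open>X\<close> also counts for
    \<open>Y\<close>, so the infimum for \<open>Y\<close> ranges over a larger set.\<close>
  have "hausdorff_measure s Y < \<infinity>" if "0 \<le> s" "hausdorff_measure s X < \<infinity>" for s
  proof -
    have "hausdorff_measure s Y \<le> ennreal (B powr s) * hausdorff_measure s X"
      using B surj that by (intro hausdorff_measure_image_le) auto
    also have "\<dots> < \<infinity>" using that by (simp add: ennreal_mult_less_top)
    finally show ?thesis .
  qed
  then show ?thesis
    using False Y unfolding hausdorff_dim_def by (auto intro!: Inf_superset_mono)
qed

text \<open>Openness of \<open>f\<close> makes the images open. For the refinement property, pull
  \<open>V\<close> back along the continuous \<open>f\<close>, choose a basis member there and push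
  it forward.\<close>

lemma topology_basis_homeomorphic_image:
  assumes f: "homeomorphic_map S T f" and basis: "topology_basis S \<U>"
  shows "topology_basis T ((`) f ` \<U>)"
  unfolding topology_basis_def
proof (intro conjI ballI allI impI)
  fix U assume "U \<in> (`) f ` \<U>"
  then show "openin T U"
    using f basis homeomorphic_imp_open_map
    by (force simp: topology_basis_def open_map_def)
next
  fix V y assume V: "openin T V \<and> y \<in> V"
  then have "y \<in> f ` topspace S"
    using f homeomorphic_imp_surjective_map openin_subset by fastforce
  then obtain x where x: "x \<in> topspace S" "y = f x" by blast
  have "openin S {x \<in> topspace S. f x \<in> V}"
    using f V homeomorphic_imp_continuous_map openin_continuous_map_preimage by blast
  then obtain U where "U \<in> \<U>" "x \<in> U" "U \<subseteq> {x \<in> topspace S. f x \<in> V}"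
    using basis V x unfolding topology_basis_def by (metis (mono_tags, lifting) mem_Collect_eq)
  then show "\<exists>U\<in>(`) f ` \<U>. y \<in> U \<and> U \<subseteq> V"
    using x by (intro bexI[of _ "f ` U"]) auto
qed

lemma bi_lipschitz_inv_into:
  assumes "bi_lipschitz X Y f"
  shows "bi_lipschitz Y X (inv_into (mspace X) f)"
proof -
  let ?g = "inv_into (mspace X) f"
  have bij: "bij_betw f (mspace X) (mspace Y)" and lip: "Lipschitz_continuous_map X Y f"
    using assms by (auto simp: bi_lipschitz_def)
  \<comment> \<open>The double inverse is known to agree with \<open>f\<close> only on the carrier,
    but the Lipschitz condition looks no further.\<close>
  have "inv_into (mspace Y) ?g x = f x" if "x \<in> mspace X" for x
    using bij that by (rule inv_into_inv_into_eq)
  then have "Lipschitz_continuous_map X Y (inv_into (mspace Y) ?g)"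
    using lip by (subst Lipschitz_continuous_map_eq) auto
  then show ?thesis
    using assms bij_betw_inv_into[OF bij] by (simp add: bi_lipschitz_def)
qed

lemma bi_lipschitz_imp_homeomorphic_map:
  assumes "bi_lipschitz X Y f"
  shows "homeomorphic_map (mtopology_of X) (mtopology_of Y) f"
proof -
  have bij: "bij_betw f (mspace X) (mspace Y)"
    using assms by (simp add: bi_lipschitz_def)
  have "homeomorphic_maps (mtopology_of X) (mtopology_of Y) f (inv_into (mspace X) f)"
    using assms bij_betw_inv_into_left[OF bij] bij_betw_inv_into_right[OF bij]
    by (simp add: homeomorphic_maps_def bi_lipschitz_def Lipschitz_continuous_imp_continuous_map)
  then show ?thesis by (simp add: homeomorphic_maps_map)
qed

lemma top_hausdorff_dim_bi_lipschitz_le: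
  assumes "bi_lipschitz X Y f"
  shows "top_hausdorff_dim Y \<le> top_hausdorff_dim X"
proof (cases "mspace X = {}")
  case True
  then show ?thesis
    using assms by (auto simp: top_hausdorff_dim_def bi_lipschitz_def bij_betw_def)
next
  case False
  have surj: "f ` mspace X = mspace Y" and lip: "Lipschitz_continuous_map X Y f"
    using assms by (auto simp: bi_lipschitz_def bij_betw_def)
  have homeo: "homeomorphic_map (mtopology_of X) (mtopology_of Y) f"
    using assms by (rule bi_lipschitz_imp_homeomorphic_map)
  have frontier: "hausdorff_dim (submetric Y (mtopology_of Y frontier_of (f ` U)))
      \<le> hausdorff_dim (submetric X (mtopology_of X frontier_of U))"
    if "U \<subseteq> mspace X" for U
  proof (rule hausdorff_dim_image_le)
    have fr: "mtopology_of Y frontier_of (f ` U) = f ` (mtopology_of X frontier_of U)"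
      using homeomorphic_map_frontier_of[OF homeo] that by simp
    \<comment> \<open>The carrier of a submetric is an intersection with the ambient carrier, so
      this inclusion is what identifies it with the frontier itself.\<close>
    have "mtopology_of X frontier_of U \<subseteq> mspace X"
      using frontier_of_subset_topspace[of "mtopology_of X" U] by simp
    then show "f ` mspace (submetric X (mtopology_of X frontier_of U))
        = mspace (submetric Y (mtopology_of Y frontier_of (f ` U)))"
      using surj by (auto simp: fr)
    then show "Lipschitz_continuous_map (submetric X (mtopology_of X frontier_of U))
        (submetric Y (mtopology_of Y frontier_of (f ` U))) f"
      using Lipschitz_continuous_map_from_submetric[OF lip]
      by (auto simp: Lipschitz_continuous_map_into_submetric)
  qed
  have "\<exists>\<V>. topology_basis (mtopology_of Y) \<V> \<and>
      (\<forall>V\<in>\<V>. hausdorff_dim (submetric Y (mtopology_of Y frontier_of V)) \<le> d - 1)"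
    if \<U>: "topology_basis (mtopology_of X) \<U>"
      "\<forall>U\<in>\<U>. hausdorff_dim (submetric X (mtopology_of X frontier_of U)) \<le> d - 1" for d \<U>
  proof -
    \<comment> \<open>Basis members are open, hence lie in the carrier, as the comparison of
      frontiers requires.\<close>
    have "U \<subseteq> mspace X" if "U \<in> \<U>" for U
      using \<U>(1) that openin_subset by (fastforce simp: topology_basis_def)
    then show ?thesis
      using topology_basis_homeomorphic_image[OF homeo \<U>(1)] \<U>(2)
      by (intro exI[of _ "(`) f ` \<U>"]) (auto intro!: order_trans[OF frontier])
  qed
  moreover have "mspace Y \<noteq> {}" using False surj by auto
  ultimately show ?thesis
    using False unfolding top_hausdorff_dim_def by (auto intro!: Inf_superset_mono)
qed

theorem corollary4p8:
  fixes X :: "'a metric" and Y :: "'b metric" and f :: "'a \<Rightarrow> 'b"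
  assumes "bi_lipschitz X Y f"
  shows "top_hausdorff_dim X = top_hausdorff_dim Y"
  using top_hausdorff_dim_bi_lipschitz_le[OF assms]
    top_hausdorff_dim_bi_lipschitz_le[OF bi_lipschitz_inv_into[OF assms]]
  by (rule antisym[rotated])

end
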